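(* Let $F$ be a field, $D$ a central simple associative division algebra over $F$, $c\in D^\times$, $\sigma_1,\sigma_2,\sigma_3,\sigma_4\in\mathrm{Aut}_F(D)$ and $A_D=\mathrm{Cay}(D,c,\sigma_1,\sigma_2,\sigma_3,\sigma_4)$. Let $G\in\mathrm{Aut}(A_D)$ be such that $G|_D=g\in\mathrm{Aut}_F(D)$. If $\sigma_3=\sigma_4$, then $G:A_D\to A_D$ must have the form $G(u,v)=(g(u),h(v)b)$ for some $h\in\mathrm{Aut}_F(D)$ such that $g\circ f=f\circ h$ for $f=\sigma_1,\sigma_2,\sigma_3^{-1},\sigma_4^{-1}$, and some $b\in F^\times$ such that $g(c)=b^2c$.
   Context: $\mathrm{Cay}(D,c,\sigma_1,\sigma_2,\sigma_3,\sigma_4)$ denotes the $F$-vector space $D\oplus D$ with the (not necessarily associative) multiplication $(u,v)(x,y)=(ux+c\sigma_1(v)\sigma_2(y),\ \sigma_3(u)y+v\sigma_4(x))$. $D$ is identified with the subalgebra $D\oplus0$, so $G|_D=g$ means $G(x,0)=(g(x),0)$ for all $x\in D$. $\mathrm{Aut}(A_D)$ is the group of $F$-algebra automorphisms of $A_D$.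
   Formalization: The formal theorem assumes that F has characteristic different from 2; without this the claim fails, e.g. for D=F=F_4, c=1, all σ_i=id, G(u,v)=(u+(1+b)v, bv) with b not in {0,1}. *)

theory Defs
  imports Complex_Main "HOL-Library.Product_Plus"
begin

locale associative_algebra = vector_space scale
  for scale :: "'f::field \<Rightarrow> 'd::ring_1 \<Rightarrow> 'd" (infixr \<open>*s\<close> 75) +
  assumes scale_mult_left: "(r *s x) * y = r *s (x * y)"
    and scale_mult_right: "x * (r *s y) = r *s (x * y)"

text \<open>
  As usual, central simple algebras are finite-dimensional. The axiom \<open>0 \<noteq> 1\<close> of the class
  \<^class>\<open>ring_1\<close> excludes the zero ring.
\<close>

locale central_simple_algebra = associative_algebra scale
  for scale :: "'f::field \<Rightarrow> 'd::ring_1 \<Rightarrow> 'd" (infixr \<open>*s\<close> 75) +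
  assumes finite_dimensional: "\<exists>B. finite_dimensional_vector_space scale B"
    and central: "{z. \<forall>x. z * x = x * z} = range (\<lambda>r. r *s 1)"
    and simple: "\<lbrakk>subspace I; \<And>x y. y \<in> I \<Longrightarrow> x * y \<in> I \<and> y * x \<in> I\<rbrakk> \<Longrightarrow> I = {0} \<or> I = UNIV"

text \<open>
  The multiplication of an algebra is passed as a parameter, because it need not be associative.
\<close>

definition algebra_Aut ::
    "('f::field \<Rightarrow> 'a::ab_group_add \<Rightarrow> 'a) \<Rightarrow> ('a \<Rightarrow> 'a \<Rightarrow> 'a) \<Rightarrow> ('a \<Rightarrow> 'a) set" where
  "algebra_Aut scale mult =
    {\<phi>. Vector_Spaces.linear scale scale \<phi> \<and> bij \<phi> \<and> (\<forall>x y. \<phi> (mult x y) = mult (\<phi> x) (\<phi> y))}"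

definition Cay_scale :: "('f \<Rightarrow> 'd \<Rightarrow> 'd) \<Rightarrow> 'f \<Rightarrow> 'd \<times> 'd \<Rightarrow> 'd \<times> 'd" where
  "Cay_scale scale r = (\<lambda>(u, v). (scale r u, scale r v))"

definition Cay_mult ::
    "'d::ring_1 \<Rightarrow> ('d \<Rightarrow> 'd) \<Rightarrow> ('d \<Rightarrow> 'd) \<Rightarrow> ('d \<Rightarrow> 'd) \<Rightarrow> ('d \<Rightarrow> 'd) \<Rightarrow> 'd \<times> 'd \<Rightarrow> 'd \<times> 'd \<Rightarrow> 'd \<times> 'd"
  where
  "Cay_mult c \<sigma>1 \<sigma>2 \<sigma>3 \<sigma>4 =
    (\<lambda>(u, v) (x, y). (u * x + c * \<sigma>1 v * \<sigma>2 y, \<sigma>3 u * y + v * \<sigma>4 x))"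

end

theory Submission
  imports Defs
begin

text \<open>
  Write \<open>\<tau>\<close> for the common value of \<open>\<sigma>3\<close> and \<open>\<sigma>4\<close>, and \<open>G (0, v) = (p v, q v)\<close>. Because \<open>\<tau>\<close> twists
  both the left and the right action of \<open>D\<close> on the second summand, applying \<open>G\<close> to the products
  \<open>(u, 0)(0, 1)\<close> and \<open>(0, 1)(u, 0)\<close>, which are both \<open>(0, \<tau> u)\<close>, gives
  \<open>p (\<tau> u) = g u * p 1 = p 1 * g u\<close> and \<open>q (\<tau> u) = \<tau> (g u) * q 1 = q 1 * \<tau> (g u)\<close>. Hence \<open>p 1\<close> and
  \<open>q 1\<close> are central, that is, scalars \<open>e\<close> and \<open>b\<close> (lemma \<open>twisted_bimodule_map_scalar\<close>). So
  \<open>q = b h\<close> with \<open>h = \<tau> \<circ> g \<circ> \<tau>\<^sup>-\<^sup>1\<close>, and \<open>g \<circ> \<tau>\<^sup>-\<^sup>1 = \<tau>\<^sup>-\<^sup>1 \<circ> h\<close>.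

  The remaining products are \<open>(0, v)(0, y)\<close>. They lie in \<open>D \<oplus> 0\<close>, so the second coordinate of
  \<open>G (0, 1) G (0, 1)\<close>, which is \<open>2 e b\<close>, vanishes. Surjectivity of \<open>G\<close> forces \<open>b \<noteq> 0\<close>, so in
  characteristic other than two \<open>e = 0\<close> and \<open>p = 0\<close>. The first coordinate then reads
  \<open>g c * g (\<sigma>1 v) * g (\<sigma>2 y) = b\<^sup>2 c * \<sigma>1 (h v) * \<sigma>2 (h y)\<close>, and setting one or both of \<open>v\<close>, \<open>y\<close> to \<open>1\<close>
  yields \<open>g c = b\<^sup>2 c\<close>, \<open>g \<circ> \<sigma>1 = \<sigma>1 \<circ> h\<close> and \<open>g \<circ> \<sigma>2 = \<sigma>2 \<circ> h\<close> by cancellation in \<open>D\<close>.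
\<close>

lemma algebra_AutD:
  assumes "\<phi> \<in> algebra_Aut scale mult"
  shows "bij \<phi>" "\<phi> (mult x y) = mult (\<phi> x) (\<phi> y)" "\<phi> (x + y) = \<phi> x + \<phi> y"
    "\<phi> (scale r x) = scale r (\<phi> x)" "\<phi> 0 = 0"
proof -
  have lin: "Vector_Spaces.linear scale scale \<phi>"
    using assms by (simp add: algebra_Aut_def)
  then show add: "\<phi> (x + y) = \<phi> x + \<phi> y" for x y
    by (simp add: Vector_Spaces.linear_iff)
  show "\<phi> (scale r x) = scale r (\<phi> x)"
    using lin by (simp add: Vector_Spaces.linear_iff)
  show "\<phi> 0 = 0"
    using add[of 0 0] by simp
qed (use assms in \<open>simp_all add: algebra_Aut_def\<close>)

lemma algebra_Aut_comp:
  assumes "\<phi> \<in> algebra_Aut scale mult" "\<psi> \<in> algebra_Aut scale mult"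
  shows "\<phi> \<circ> \<psi> \<in> algebra_Aut scale mult"
  using assms by (auto simp: algebra_Aut_def bij_comp Vector_Spaces.linear_iff)

lemma algebra_Aut_inv:
  assumes "\<phi> \<in> algebra_Aut scale mult"
  shows "inv \<phi> \<in> algebra_Aut scale mult"
proof -
  note \<phi> = algebra_AutD[OF assms]
  have inv_eq: "inv \<phi> x = y \<longleftrightarrow> x = \<phi> y" for x y
    using \<phi>(1) by (metis bij_inv_eq_iff)
  have [simp]: "\<phi> (inv \<phi> x) = x" for x
    using inv_eq[of x "inv \<phi> x"] by simp
  have "vector_space scale"
    using assms by (simp add: algebra_Aut_def Vector_Spaces.linear_iff)
  then show ?thesis
    unfolding algebra_Aut_def mem_Collect_eq Vector_Spaces.linear_iff
    using \<phi>(1) by (simp add: bij_imp_bij_inv inv_eq \<phi>)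
qed

lemma algebra_Aut_one:
  fixes \<phi> :: "'d::ring_1 \<Rightarrow> 'd"
  assumes "\<phi> \<in> algebra_Aut scale (*)"
  shows "\<phi> 1 = 1"
proof -
  obtain x where "\<phi> x = 1"
    using algebra_AutD(1)[OF assms] by (metis bij_pointE)
  then show ?thesis
    using algebra_AutD(2)[OF assms, of x 1] by simp
qed

text \<open>
  A Schur-type fact. View \<open>D\<close> as a bimodule over itself, once with both actions twisted by \<open>\<tau>\<close> and
  once with both twisted by \<open>\<rho>\<close>. A bimodule map from the first to the second is determined on the
  image of \<open>\<tau>\<close> by its value at \<open>1\<close>, and that value commutes with the image of \<open>\<rho>\<close>, which is all of
  \<open>D\<close>; so it lies in the centre.
\<close>

lemma (in central_simple_algebra) twisted_bimodule_map_scalar: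
  fixes f \<tau> \<rho> :: "'d \<Rightarrow> 'd"
  assumes left: "\<And>u y. f (\<tau> u * y) = \<rho> u * f y"
    and right: "\<And>u y. f (y * \<tau> u) = f y * \<rho> u"
    and "surj \<rho>"
  obtains r where "f 1 = r *s 1" "\<And>u. f (\<tau> u) = r *s \<rho> u"
proof -
  have left_1: "f (\<tau> u) = \<rho> u * f 1" for u
    using left[of u 1] by simp
  moreover have "f (\<tau> u) = f 1 * \<rho> u" for u
    using right[of 1 u] by simp
  ultimately have "\<rho> u * f 1 = f 1 * \<rho> u" for u
    by (rule subst)
  then have "f 1 * x = x * f 1" for x
    using \<open>surj \<rho>\<close> by (metis surjD)
  then have "f 1 \<in> range (\<lambda>r. r *s 1)"
    using central by blast
  then obtain r where r: "f 1 = r *s 1"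
    by blast
  have "f (\<tau> u) = r *s \<rho> u" for u
    by (simp add: left_1 r scale_mult_right)
  with r show thesis
    by (rule that)
qed

theorem theorem2p19:
  fixes scale :: "'f::field \<Rightarrow> 'd::division_ring \<Rightarrow> 'd"
    and c :: 'd
    and \<sigma>1 \<sigma>2 \<sigma>3 \<sigma>4 g :: "'d \<Rightarrow> 'd"
    and G :: "'d \<times> 'd \<Rightarrow> 'd \<times> 'd"
  assumes char_not_2: "(2::'f) \<noteq> 0"
    and D: "central_simple_algebra scale"
    and "c \<noteq> 0"
    and "\<sigma>1 \<in> algebra_Aut scale (*)" "\<sigma>2 \<in> algebra_Aut scale (*)"
    and "\<sigma>3 \<in> algebra_Aut scale (*)" "\<sigma>4 \<in> algebra_Aut scale (*)"
    and "G \<in> algebra_Aut (Cay_scale scale) (Cay_mult c \<sigma>1 \<sigma>2 \<sigma>3 \<sigma>4)"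
    and "g \<in> algebra_Aut scale (*)"
    and "\<forall>x. G (x, 0) = (g x, 0)"
    and "\<sigma>3 = \<sigma>4"
  shows "\<exists>h \<in> algebra_Aut scale (*). \<exists>b::'f. b \<noteq> 0 \<and>
    (\<forall>f \<in> {\<sigma>1, \<sigma>2, inv \<sigma>3, inv \<sigma>4}. g \<circ> f = f \<circ> h) \<and>
    g c = scale (b ^ 2) c \<and>
    (\<forall>u v. G (u, v) = (g u, scale b (h v)))"
proof -
  interpret central_simple_algebra scale by (fact D)
  define \<tau> where "\<tau> = \<sigma>3"
  have \<sigma>3: "\<sigma>3 = \<tau>" and \<sigma>4: "\<sigma>4 = \<tau>"
    using \<open>\<sigma>3 = \<sigma>4\<close> by (simp_all add: \<tau>_def)
  have aut_\<tau>: "\<tau> \<in> algebra_Aut scale (*)"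
    using \<open>\<sigma>3 \<in> _\<close> by (simp add: \<sigma>3)
  note aut_\<sigma>1 = \<open>\<sigma>1 \<in> _\<close> and aut_\<sigma>2 = \<open>\<sigma>2 \<in> _\<close> and aut_g = \<open>g \<in> _\<close>
  note \<tau> = algebra_AutD[OF aut_\<tau>] algebra_Aut_one[OF aut_\<tau>]
    and \<sigma>1 = algebra_AutD[OF aut_\<sigma>1] algebra_Aut_one[OF aut_\<sigma>1]
    and \<sigma>2 = algebra_AutD[OF aut_\<sigma>2] algebra_Aut_one[OF aut_\<sigma>2]
    and g = algebra_AutD[OF aut_g] algebra_Aut_one[OF aut_g]
    and G = algebra_AutD[OF \<open>G \<in> _\<close>]
  have G_D: "G (x, 0) = (g x, 0)" for x
    using assms(10) by blast
  have G_mult: "G (u * x + c * \<sigma>1 v * \<sigma>2 y, \<tau> u * y + v * \<tau> x)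
      = Cay_mult c \<sigma>1 \<sigma>2 \<tau> \<tau> (G (u, v)) (G (x, y))" for u v x y
    using G(2)[of "(u, v)" "(x, y)"] by (simp add: Cay_mult_def \<sigma>3 \<sigma>4)

  define p where "p v = fst (G (0, v))" for v
  define q where "q v = snd (G (0, v))" for v
  have G_0: "G (0, v) = (p v, q v)" for v
    by (simp add: p_def q_def)
  have G_uv: "G (u, v) = (g u + p v, q v)" for u v
    using G(3)[of "(u, 0)" "(0, v)"] by (simp add: G_D G_0)
  have left: "p (\<tau> u * y) = g u * p y" "q (\<tau> u * y) = \<tau> (g u) * q y" for u y
    using G_mult[of u 0 0 y] by (simp_all add: G_D G_0 Cay_mult_def \<tau> \<sigma>1 \<sigma>2)
  have right: "p (v * \<tau> x) = p v * g x" "q (v * \<tau> x) = q v * \<tau> (g x)" for v x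
    using G_mult[of 0 x v 0] by (simp_all add: G_D G_0 Cay_mult_def \<tau> \<sigma>1 \<sigma>2)

  have "surj (\<lambda>x. \<tau> (g x))"
    using bij_comp[OF g(1) \<tau>(1)] by (simp add: bij_is_surj comp_def)
  then obtain b where b: "q 1 = scale b 1" "\<And>u. q (\<tau> u) = scale b (\<tau> (g u))"
    using twisted_bimodule_map_scalar[of q \<tau> "\<lambda>x. \<tau> (g x)", OF left(2) right(2)] by blast
  obtain e where e: "p 1 = scale e 1" "\<And>u. p (\<tau> u) = scale e (g u)"
    using twisted_bimodule_map_scalar[of p \<tau> g, OF left(1) right(1) bij_is_surj[OF g(1)]] by blast

  define h where "h = \<tau> \<circ> g \<circ> inv \<tau>"
  have aut_h: "h \<in> algebra_Aut scale (*)"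
    unfolding h_def by (intro algebra_Aut_comp algebra_Aut_inv aut_\<tau> aut_g)
  have \<tau>_inv: "\<tau> (inv \<tau> x) = x" "inv \<tau> (\<tau> x) = x" for x
    using \<tau>(1) by (simp_all add: bij_is_surj surj_f_inv_f bij_is_inj)
  have q_h: "q v = scale b (h v)" for v
    using b(2)[of "inv \<tau> v"] by (simp add: h_def \<tau>_inv)
  have "b \<noteq> 0"
  proof
    assume "b = 0"
    moreover obtain u v where "G (u, v) = (0, 1)"
      using G(1) by (metis bij_pointE prod.exhaust)
    ultimately show False
      by (simp add: G_uv q_h)
  qed

  have G_sq: "(g (c * \<sigma>1 v * \<sigma>2 y), 0) = Cay_mult c \<sigma>1 \<sigma>2 \<tau> \<tau> (p v, q v) (p y, q y)" for v y
    using G_mult[of 0 0 v y] by (simp add: G_D G_0 \<tau>)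
  \<comment> \<open>The second coordinate at \<open>v = y = 1\<close> says \<open>2 e b = 0\<close>.\<close>
  have "e = 0"
    using G_sq[of 1 1] char_not_2 \<open>b \<noteq> 0\<close>
    by (auto simp: Cay_mult_def e b \<tau> scale_mult_left scale_mult_right simp flip: scale_left_distrib)
  have p_0: "p v = 0" for v
    using e(2)[of "inv \<tau> v"] \<open>e = 0\<close> by (simp add: \<tau>_inv)

  have key: "g c * g (\<sigma>1 v) * g (\<sigma>2 y) = scale (b ^ 2) c * \<sigma>1 (h v) * \<sigma>2 (h y)" for v y
    using G_sq[of v y]
    by (simp add: Cay_mult_def p_0 q_h \<sigma>1 \<sigma>2 g scale_mult_left scale_mult_right power2_eq_square)
  note one = \<sigma>1(6) \<sigma>2(6) g(6) algebra_Aut_one[OF aut_h]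
  have g_c: "g c = scale (b ^ 2) c"
    using key[of 1 1] by (simp add: one)
  have "scale (b ^ 2) c \<noteq> 0"
    using \<open>b \<noteq> 0\<close> \<open>c \<noteq> 0\<close> by simp
  then have "g (\<sigma>1 v) = \<sigma>1 (h v)" "g (\<sigma>2 v) = \<sigma>2 (h v)" for v
    using key[of v 1] key[of 1 v] by (simp_all add: one g_c)
  moreover have "g (inv \<tau> v) = inv \<tau> (h v)" for v
    by (simp add: h_def \<tau>_inv)
  ultimately have "\<forall>f \<in> {\<sigma>1, \<sigma>2, inv \<sigma>3, inv \<sigma>4}. g \<circ> f = f \<circ> h"
    by (auto simp: \<sigma>3 \<sigma>4 fun_eq_iff)
  then show ?thesis
    using aut_h \<open>b \<noteq> 0\<close> g_c by (auto simp: G_uv p_0 q_h)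
qed

end
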